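(* Let $D$ be an oriented graph on $n$ vertices with minimum degree $\delta=\delta(D)$ satisfying $1<\delta<\frac{n}{2}$. If $d(u)+d(v)\ge n+\delta-2$ for each pair of non-adjacent vertices $u$ and $v$ of $D$, then there exists a Hamilton oriented cycle $C$ in $D$ such that $\sigma_{\max}(C)\ge n-\delta$.
   Context: An oriented graph is a finite loopless digraph with at most one arc between any pair of vertices. The degree $d(x)$ of a vertex $x$ in $D$ is its degree in the underlying undirected graph $U(D)$ (obtained by removing the orientations of all arcs), i.e. the number of arcs incident with $x$; $\delta(D)$ is the minimum of $d(x)$ over all vertices $x$. Two distinct vertices are non-adjacent if there is no arc between them (in either direction). An oriented cycle in $D$ is a subdigraph $Q$ of $D$ whose underlying graph $U(Q)$ is a cycle in $U(D)$ (arcs need not be consistently oriented); it is Hamilton if it is spanning. For an oriented cycle $C=x_1x_2\dots x_tx_1$ (indices modulo $t$), the arc of $C$ between $x_i$ and $x_{i+1}$ is forward if it is directed from $x_i$ to $x_{i+1}$ and backward if it is directed from $x_{i+1}$ to $x_i$. $\sigma^+(C)$ and $\sigma^-(C)$ denote the numbers of forward and backward arcs of $C$, respectively, and $\sigma_{\max}(C)=\max\{\sigma^+(C),\sigma^-(C)\}$ (which does not depend on the direction of traversal). *)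

theory Defs
  imports Complex_Main "Graph_Theory.Digraph_Component"
begin

locale oriented_graph = fin_digraph + loopfree_digraph +
  assumes at_most_one_arc:
    "\<lbrakk>e1 \<in> arcs G; e2 \<in> arcs G; {tail G e1, head G e1} = {tail G e2, head G e2}\<rbrakk> \<Longrightarrow> e1 = e2"

sublocale oriented_graph \<subseteq> digraph
  by unfold_locales (rule at_most_one_arc, auto simp: arc_to_ends_def)

text \<open>The number of arcs incident with a vertex, which in an oriented graph is its degree
  in the underlying undirected graph.\<close>

definition degree :: "('a, 'b) pre_digraph \<Rightarrow> 'a \<Rightarrow> nat" where
  "degree D x = card (in_arcs D x \<union> out_arcs D x)"

definition min_degree :: "('a, 'b) pre_digraph \<Rightarrow> nat" where
  "min_degree D = Min (degree D ` verts D)"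

definition adjacent :: "('a, 'b) pre_digraph \<Rightarrow> 'a \<Rightarrow> 'a \<Rightarrow> bool" where
  "adjacent D u v \<longleftrightarrow> u \<rightarrow>\<^bsub>D\<^esub> v \<or> v \<rightarrow>\<^bsub>D\<^esub> u"

definition cyc_next :: "'a list \<Rightarrow> nat \<Rightarrow> 'a" where
  "cyc_next xs i = xs ! (Suc i mod length xs)"

text \<open>The underlying graph of \<open>Q\<close>, rendered as the symmetric digraph \<open>mk_symmetric Q\<close>,
  is the cycle \<open>x\<^sub>1 x\<^sub>2 \<dots> x\<^sub>t x\<^sub>1\<close>, where \<open>xs = [x\<^sub>1, \<dots>, x\<^sub>t]\<close>. The condition \<open>3 \<le> t\<close> is that of
  cycles in simple undirected graphs.\<close>

definition cycle_traversal :: "('a, 'b) pre_digraph \<Rightarrow> 'a list \<Rightarrow> bool" where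
  "cycle_traversal Q xs \<longleftrightarrow>
     3 \<le> length xs \<and> distinct xs \<and>
     pverts (mk_symmetric Q) = set xs \<and>
     parcs (mk_symmetric Q) =
       (\<Union>i\<in>{..<length xs}. {(xs ! i, cyc_next xs i), (cyc_next xs i, xs ! i)})"

definition oriented_cycle :: "('a, 'b) pre_digraph \<Rightarrow> ('a, 'b) pre_digraph \<Rightarrow> bool" where
  "oriented_cycle D Q \<longleftrightarrow> subgraph Q D \<and> (\<exists>xs. cycle_traversal Q xs)"

definition hamilton_oriented_cycle :: "('a, 'b) pre_digraph \<Rightarrow> ('a, 'b) pre_digraph \<Rightarrow> bool" where
  "hamilton_oriented_cycle D Q \<longleftrightarrow> oriented_cycle D Q \<and> spanning Q D"

text \<open>Forward and backward arcs refer to a direction of traversal, so the following take a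
  traversal \<open>xs\<close> of \<open>Q\<close>; the value of \<open>sigma_max\<close> is the same for all traversals of \<open>Q\<close>.\<close>

definition sigma_plus :: "('a, 'b) pre_digraph \<Rightarrow> 'a list \<Rightarrow> nat" where
  "sigma_plus Q xs = card {i. i < length xs \<and> xs ! i \<rightarrow>\<^bsub>Q\<^esub> cyc_next xs i}"

definition sigma_minus :: "('a, 'b) pre_digraph \<Rightarrow> 'a list \<Rightarrow> nat" where
  "sigma_minus Q xs = card {i. i < length xs \<and> cyc_next xs i \<rightarrow>\<^bsub>Q\<^esub> xs ! i}"

definition sigma_max :: "('a, 'b) pre_digraph \<Rightarrow> 'a list \<Rightarrow> nat" where
  "sigma_max Q xs = max (sigma_plus Q xs) (sigma_minus Q xs)"

end

theory Submission
  imports Defs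
begin

text \<open>
  Let \<open>x\<close> be a vertex of degree \<open>\<delta>\<close>, let \<open>T\<close> be the set of its \<open>\<delta>\<close> neighbours and \<open>S\<close> the set of
  the \<open>s = n - 1 - \<delta>\<close> remaining vertices; \<open>\<delta> < n/2\<close> gives \<open>s \<ge> \<delta>\<close>. Applied to \<open>x\<close> and a vertex of
  \<open>S\<close>, the degree condition says that each vertex of \<open>S\<close> has degree at least \<open>n - 2\<close>, so it is adjacent
  to every vertex except \<open>x\<close> and itself. Hence \<open>S\<close> induces a tournament, which has a directed
  Hamilton path \<open>v\<^sub>1 \<dots> v\<^sub>s\<close>, and all pairs between \<open>S\<close> and \<open>T\<close> are adjacent. It remains to find
  a Hamilton oriented cycle with at most \<open>\<delta>\<close> backward arcs.

  Such a cycle comes from averaging. Close the path up cyclically, so that it has \<open>s\<close> gaps,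
  the last one between \<open>v\<^sub>s\<close> and \<open>v\<^sub>1\<close>. Split \<open>T\<close> into two vertices \<open>t\<^sub>0, t\<^sub>1\<close>, which will be the
  neighbours of \<open>x\<close> on the cycle, and \<open>\<delta> - 2\<close> others; insert the segment \<open>t\<^sub>0 x t\<^sub>1\<close> into one gap
  and the others, one by one, into the gaps that follow it. Average over all \<open>s\<close> rotations
  of the path and over both ways to name \<open>t\<^sub>0\<close> and \<open>t\<^sub>1\<close>. Each pair \<open>v \<in> S, t \<in> T\<close> is as often
  traversed from \<open>v\<close> to \<open>t\<close> as from \<open>t\<close> to \<open>v\<close>, and likewise the pairs \<open>x, t\<^sub>0\<close> and \<open>x, t\<^sub>1\<close>; each of
  these pairs is backward in one direction only. So half of the \<open>2\<delta>\<close> steps that touch \<open>T\<close>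
  are backward on average. A gap left empty is backward only if it is the last one, and
  this happens with probability at most \<open>(s - \<delta> + 1) / s < 1\<close>. The mean number of backward
  arcs is therefore less than \<open>\<delta> + 1\<close>, and some choice has at most \<open>\<delta>\<close> of them.

  The averaging is \<open>exists_few_backward\<close>, the path is \<open>tournament_hamilton_path\<close>, and
  \<open>hamilton_cycle_of_list\<close> turns a list of vertices into the required subdigraph.
\<close>

section \<open>Backward steps along a list of vertices\<close>

text \<open>A step \<open>u v\<close> counts as backward when \<open>R u v\<close> fails; for adjacent vertices of an oriented graph
  this means that the arc between them points from \<open>v\<close> to \<open>u\<close>.\<close>

fun backward :: "('a \<Rightarrow> 'a \<Rightarrow> bool) \<Rightarrow> 'a list \<Rightarrow> nat" where
  "backward R (u # v # xs) = of_bool (\<not> R u v) + backward R (v # xs)"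
| "backward R _ = 0"

lemma backward_append:
  assumes "xs \<noteq> []" "ys \<noteq> []"
  shows "backward R (xs @ ys) =
    backward R xs + of_bool (\<not> R (last xs) (hd ys)) + backward R ys"
  using assms by (induction R xs rule: backward.induct) (auto simp: neq_Nil_conv)

lemma backward_conv_sum:
  "backward R xs = (\<Sum>i<length xs - 1. of_bool (\<not> R (xs ! i) (xs ! Suc i)))"
  by (induction R xs rule: backward.induct)
    (simp_all add: sum.lessThan_Suc_shift del: sum.lessThan_Suc)

text \<open>Since \<open>ms\<close> is shorter than \<open>ws\<close>, each entry of \<open>ms\<close> lies between two consecutive entries of
  \<open>ws\<close>, and the rest of \<open>ws\<close> follows as a block.\<close>

lemma backward_splice:
  assumes "length ms < length ws"
  shows "backward R (splice ws ms) =
    (\<Sum>j<length ms. of_bool (\<not> R (ws ! j) (ms ! j)) + of_bool (\<not> R (ms ! j) (ws ! Suc j))) +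
    (\<Sum>j\<in>{length ms..<length ws - 1}. of_bool (\<not> R (ws ! j) (ws ! Suc j)))"
  using assms
proof (induction ms arbitrary: ws)
  case Nil
  then show ?case by (simp add: backward_conv_sum atLeast0LessThan)
next
  case (Cons t ms)
  then obtain v w vs where ws: "ws = v # w # vs"
    by (metis Suc_less_eq length_Cons not_less_zero neq_Nil_conv list.size(3))
  have "backward R (splice (w # vs) ms) =
      (\<Sum>j<length ms. of_bool (\<not> R ((w#vs) ! j) (ms ! j)) + of_bool (\<not> R (ms ! j) ((w#vs) ! Suc j))) +
      (\<Sum>j\<in>{length ms..<length vs}. of_bool (\<not> R ((w#vs) ! j) ((w#vs) ! Suc j)))"
    using Cons.IH[of "w # vs"] Cons.prems ws by simp
  then show ?case
    using ws by (simp add: sum.lessThan_Suc_shift sum.shift_bounds_Suc_ivl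
        del: sum.lessThan_Suc sum.op_ivl_Suc)
qed

lemma hd_splice: "ws \<noteq> [] \<Longrightarrow> hd (splice ws ms) = hd ws"
  by (cases ws) auto

lemma last_splice: "length ms < length ws \<Longrightarrow> last (splice ws ms) = last ws"
proof (induction ms arbitrary: ws)
  case (Cons t ms)
  then obtain v w vs where ws: "ws = v # w # vs"
    by (metis Suc_less_eq length_Cons not_less_zero neq_Nil_conv list.size(3))
  show ?case using Cons.IH[of "w # vs"] Cons.prems ws by simp
qed simp

lemma successively_splice:
  assumes "length ms < length ws" "distinct ws"
    and "\<And>u v. u \<in> set ws \<Longrightarrow> v \<in> set ws \<Longrightarrow> u \<noteq> v \<Longrightarrow> A u v"
    and "\<And>v t. v \<in> set ws \<Longrightarrow> t \<in> set ms \<Longrightarrow> A v t \<and> A t v"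
  shows "successively A (splice ws ms)"
  using assms
proof (induction ms arbitrary: ws)
  case Nil
  then show ?case 
    by (auto simp: successively_conv_nth nth_eq_iff_index_eq)
next
  case (Cons t ms)
  then obtain v w vs where ws: "ws = v # w # vs"
    by (metis Suc_less_eq length_Cons not_less_zero neq_Nil_conv list.size(3))
  have "successively A (splice (w # vs) ms)" 
    using Cons.prems ws by (intro Cons.IH) auto
  then show ?case using Cons.prems ws by (auto simp: successively_Cons)
qed

lemma sum_rotated_index:
  fixes g :: "nat \<Rightarrow> 'b :: comm_monoid_add"
  assumes "j < s"
  shows "(\<Sum>r<s. g ((r + j) mod s)) = (\<Sum>i<s. g i)"
proof (rule sum.reindex_bij_witness[where j = "\<lambda>r. (r + j) mod s" and i = "\<lambda>i. (i + (s - j)) mod s"])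
  fix r assume "r \<in> {..<s}"
  then show "((r + j) mod s + (s - j)) mod s = r"
    using assms by (subst mod_add_left_eq) simp
  show "(r + j) mod s \<in> {..<s}" using assms by simp
next
  fix i assume "i \<in> {..<s}"
  then show "((i + (s - j)) mod s + j) mod s = i"
    using assms by (subst mod_add_left_eq) simp
  show "(i + (s - j)) mod s \<in> {..<s}" using assms by simp
qed simp

section \<open>Directed Hamilton paths in tournaments\<close>

text \<open>The vertex \<open>v\<close> goes in front of the first entry that it dominates, or to the end. The condition on
  the head lets the induction attach the preceding entry of the path.\<close>

lemma tournament_insert:
  assumes "xs \<noteq> []" "successively R xs" "\<And>u. u \<in> set xs \<Longrightarrow> R u v \<or> R v u"
  shows "\<exists>ys. ys \<noteq> [] \<and> hd ys \<in> {v, hd xs} \<and> mset ys = add_mset v (mset xs) \<and> successively R ys"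
  using assms
proof (induction xs)
  case (Cons a xs)
  consider "R v a" | "R a v" "xs = []" | "R a v" "xs \<noteq> []" using Cons.prems by auto
  then show ?case
  proof cases
    case 1
    then show ?thesis using Cons.prems by (intro exI[of _ "v # a # xs"]) auto
  next
    case 2
    then show ?thesis by (intro exI[of _ "[a, v]"]) auto
  next
    case 3
    obtain ys where ys: "ys \<noteq> []" "hd ys \<in> {v, hd xs}" "mset ys = add_mset v (mset xs)"
        "successively R ys"
      using Cons.IH 3 Cons.prems by (auto simp: successively_Cons)
    then show ?thesis using 3 Cons.prems
      by (intro exI[of _ "a # ys"]) (auto simp: successively_Cons)
  qed
qed simp

lemma tournament_hamilton_path:
  assumes "finite S" "\<And>u v. u \<in> S \<Longrightarrow> v \<in> S \<Longrightarrow> u \<noteq> v \<Longrightarrow> R u v \<or> R v u"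
  shows "\<exists>xs. distinct xs \<and> set xs = S \<and> successively R xs"
  using assms
proof (induction S)
  case (insert v S)
  then obtain xs where xs: "distinct xs" "set xs = S" "successively R xs" by auto
  show ?case
  proof (cases "xs = []")
    case True
    then show ?thesis using xs by (intro exI[of _ "[v]"]) auto
  next
    case False
    have "\<And>u. u \<in> set xs \<Longrightarrow> R u v \<or> R v u" using insert xs by auto
    then obtain ys where ys: "mset ys = mset (v # xs)" "successively R ys"
      using tournament_insert[OF False xs(3), of v] by auto
    have "distinct ys" "set ys = insert v S"
      using ys(1) xs insert mset_eq_imp_distinct_iff[OF ys(1)] mset_eq_setD[OF ys(1)] by auto
    then show ?thesis using ys by auto
  qed
qed simp

section \<open>Averaging over rotations\<close>

text \<open>The averaging argument, with \<open>vs\<close> the Hamilton path of the tournament and \<open>{t0, t1} \<union> set ms\<close>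
  the neighbourhood of \<open>x\<close>. Rotating \<open>vs\<close> moves every inserted vertex through all the gaps.\<close>

lemma exists_few_backward:
  assumes path: "successively R vs"
    and len: "length ms + 2 \<le> length vs"
    and vt: "\<And>v t. v \<in> set vs \<Longrightarrow> t \<in> {t0, t1} \<union> set ms \<Longrightarrow> R t v \<longleftrightarrow> \<not> R v t"
    and xt: "\<And>t. t \<in> {t0, t1} \<Longrightarrow> R t x \<longleftrightarrow> \<not> R x t"
  shows "\<exists>r t t'. {t, t'} = {t0, t1} \<and>
    backward R (x # t # splice (rotate r vs) ms @ [t', x]) \<le> length ms + 2"
proof (rule ccontr)
  define s m where "s = length vs" and "m = length ms"
  define c :: "'a \<Rightarrow> 'a \<Rightarrow> nat" where "c u v = of_bool (\<not> R u v)" for u v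
  define P where "P r = backward R (splice (rotate r vs) ms)" for r
  define F where "F t t' r = backward R (x # t # splice (rotate r vs) ms @ [t', x])" for t t' r
  assume "\<not> ?thesis"
  then have "\<not> F t0 t1 r \<le> m + 2" "\<not> F t1 t0 r \<le> m + 2" for r
    unfolding F_def m_def by (blast intro: insert_commute)+
  then have large: "m + 3 \<le> F t0 t1 r" "m + 3 \<le> F t1 t0 r" for r
    by (simp_all add: not_le Suc_le_eq eval_nat_numeral)
  have s: "m + 2 \<le> s" using len by (simp add: s_def m_def)
  have nth: "rotate r vs ! j = vs ! ((r + j) mod s)" if "j < s" for r j
    using that by (simp add: nth_rotate s_def)
  have rot: "(\<Sum>r<s. f (rotate r vs ! j)) = (\<Sum>i<s. f (vs ! i))" if "j < s" 
    for j and f :: "'a \<Rightarrow> nat"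
    using sum_rotated_index[OF that, of "\<lambda>i. f (vs ! i)"] that by (simp add: nth)
  \<comment> \<open>Over a full turn, entering and leaving \<open>t\<close> together meet every pair \<open>{v, t}\<close> once in each direction.\<close>
  have both: "(\<Sum>i<s. c (vs ! i) t) + (\<Sum>i<s. c t (vs ! i)) = s"
    if "t \<in> {t0, t1} \<union> set ms" for t
  proof -
    have "(\<Sum>i<s. c (vs ! i) t) + (\<Sum>i<s. c t (vs ! i)) = (\<Sum>i<s. c (vs ! i) t + c t (vs ! i))"
      by (simp add: sum.distrib)
    also have "\<dots> = (\<Sum>i<s. 1)"
      using vt[OF _ that] by (intro sum.cong) (auto simp: c_def s_def)
    finally show ?thesis by simp
  qed
  \<comment> \<open>A step inside the rotated path is forward unless it wraps around from the last vertex to the first.\<close>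
  have step: "(\<Sum>r<s. c (rotate r vs ! j) (rotate r vs ! Suc j)) \<le> 1" if "Suc j < s" for j
  proof -
    have "(\<Sum>r<s. c (rotate r vs ! j) (rotate r vs ! Suc j))
        = (\<Sum>r<s. c (vs ! ((r + j) mod s)) (vs ! (Suc ((r + j) mod s) mod s)))"
      using that by (simp add: nth mod_Suc_eq)
    also have "\<dots> = (\<Sum>i<s. c (vs ! i) (vs ! (Suc i mod s)))"
      using that by (subst sum_rotated_index[of j s "\<lambda>i. c (vs ! i) (vs ! (Suc i mod s))"]) auto
    also have "\<dots> = (\<Sum>i<Suc (s - 1). c (vs ! i) (vs ! (Suc i mod s)))"
      using s by simp
    also have "\<dots> \<le> 1"
      unfolding sum.lessThan_Suc
      using successively_nth[OF path] by (simp add: c_def s_def)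
    finally show ?thesis .
  qed
  have "(\<Sum>r<s. P r) = (\<Sum>j<m. (\<Sum>r<s. c (rotate r vs ! j) (ms ! j)) +
        (\<Sum>r<s. c (ms ! j) (rotate r vs ! Suc j))) +
      (\<Sum>j\<in>{m..<s - 1}. \<Sum>r<s. c (rotate r vs ! j) (rotate r vs ! Suc j))"
  proof -
    have "P r = (\<Sum>j<m. c (rotate r vs ! j) (ms ! j) + c (ms ! j) (rotate r vs ! Suc j)) +
      (\<Sum>j\<in>{m..<s - 1}. c (rotate r vs ! j) (rotate r vs ! Suc j))" for r
      using backward_splice[of ms "rotate r vs" R] s unfolding P_def c_def s_def m_def by simp
    then show ?thesis by (simp add: sum.distrib sum.swap[of _ "{..<s}"])
  qed
  also have "\<dots> \<le> (\<Sum>j<m. s) + (\<Sum>j\<in>{m..<s - 1}. 1)"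
  proof (intro add_mono sum_mono)
    fix j assume "j \<in> {..<m}"
    then have "ms ! j \<in> set ms" "j < s" "Suc j < s" using s by (auto simp: m_def)
    then show "(\<Sum>r<s. c (rotate r vs ! j) (ms ! j)) + (\<Sum>r<s. c (ms ! j) (rotate r vs ! Suc j)) \<le> s"
      using both[of "ms ! j"] by (simp add: rot[where f="\<lambda>v. c v (ms ! j)"] rot)
  qed (use step in auto)
  finally have P: "(\<Sum>r<s. P r) \<le> m * s + (s - 1 - m)" by simp
  have F: "F t t' r = c x t + c t (rotate r vs ! 0) + P r + c (rotate r vs ! (s - 1)) t' + c t' x"
    for t t' r
  proof -
    have ne: "rotate r vs \<noteq> []" "length ms < length (rotate r vs)" using s by (auto simp: s_def m_def)
    then have *: "splice (rotate r vs) ms \<noteq> []" by simp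
    have "F t t' r = backward R ([x, t] @ (splice (rotate r vs) ms @ [t', x]))" by (simp add: F_def)
    also have "\<dots> = c x t + c t (hd (rotate r vs)) + (P r + c (last (rotate r vs)) t' + c t' x)"
      using * ne by (subst backward_append) (auto simp: backward_append hd_splice last_splice P_def c_def)
    finally show ?thesis using ne by (simp add: hd_conv_nth last_conv_nth s_def)
  qed
  have xx: "c x t + c t x = 1" if "t \<in> {t0, t1}" for t using xt[OF that] by (simp add: c_def)
  \<comment> \<open>A single choice of roles counts only the steps from \<open>x\<close> to \<open>t0\<close>, from \<open>t0\<close> to the path, and the
    opposite ones for \<open>t1\<close>; adding the exchanged choice makes both directions occur equally often.\<close>
  have "(\<Sum>r<s. F t0 t1 r) + (\<Sum>r<s. F t1 t0 r) = 
      s * (c x t0 + c t0 x) + s * (c x t1 + c t1 x) + 2 * (\<Sum>r<s. P r) +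
      ((\<Sum>i<s. c (vs ! i) t0) + (\<Sum>i<s. c t0 (vs ! i))) +
      ((\<Sum>i<s. c (vs ! i) t1) + (\<Sum>i<s. c t1 (vs ! i)))"
    using s by (simp add: F sum.distrib rot[where f="\<lambda>v. c v _"] rot algebra_simps)
  also have "\<dots> \<le> 4 * s + 2 * (m * s + (s - 1 - m))"
    using P by (simp add: xx both)
  also have "\<dots> < 2 * (s * (m + 3))"
    using s by (simp add: algebra_simps)
  also have "\<dots> = (\<Sum>r<s. m + 3) + (\<Sum>r<s. m + 3)" by simp
  also have "\<dots> \<le> (\<Sum>r<s. F t0 t1 r) + (\<Sum>r<s. F t1 t0 r)"
    using large by (intro add_mono sum_mono) 
  finally show False by simp
qed


section \<open>Oriented graphs\<close>

lemma (in oriented_graph) adjacent_sym: "adjacent G u v \<longleftrightarrow> adjacent G v u"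
  by (auto simp: adjacent_def)

lemma (in oriented_graph) dominates_antisym:
  assumes "u \<rightarrow>\<^bsub>G\<^esub> v"
  shows "\<not> v \<rightarrow>\<^bsub>G\<^esub> u"
proof
  assume "v \<rightarrow>\<^bsub>G\<^esub> u"
  then obtain e where e: "e \<in> arcs G" "tail G e = v" "head G e = u" by auto
  obtain f where f: "f \<in> arcs G" "tail G f = u" "head G f = v" using assms by auto
  have "e = f" using e f by (intro at_most_one_arc) auto
  then show False using e f no_loops[of e] by auto
qed

lemma (in oriented_graph) adjacent_iff_one_way:
  assumes "adjacent G u v"
  shows "u \<rightarrow>\<^bsub>G\<^esub> v \<longleftrightarrow> \<not> v \<rightarrow>\<^bsub>G\<^esub> u"
  using assms dominates_antisym by (auto simp: adjacent_def)

lemma (in oriented_graph) adjacentD: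
  assumes "adjacent G u v"
  shows "u \<in> verts G" "v \<in> verts G" "u \<noteq> v"
  using assms adj_not_same by (auto simp: adjacent_def)

lemma (in oriented_graph) degree_eq_card_neighbours:
  "degree G v = card {u. adjacent G v u}"
proof -
  let ?other = "\<lambda>e. if tail G e = v then head G e else tail G e"
  have "inj_on ?other (in_arcs G v \<union> out_arcs G v)"
    by (rule inj_onI, rule at_most_one_arc) (auto split: if_splits)
  moreover have "?other ` (in_arcs G v \<union> out_arcs G v) = {u. adjacent G v u}"
  proof (intro equalityI subsetI)
    fix u assume "u \<in> ?other ` (in_arcs G v \<union> out_arcs G v)"
    then show "u \<in> {u. adjacent G v u}"
      by (auto simp: adjacent_def arcs_ends_conv image_iff split: if_splits)
  next
    fix u assume "u \<in> {u. adjacent G v u}"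
    then obtain e where "e \<in> arcs G" "tail G e = v \<and> head G e = u \<or> tail G e = u \<and> head G e = v"
      unfolding adjacent_def by auto
    then show "u \<in> ?other ` (in_arcs G v \<union> out_arcs G v)"
      using no_loops by (intro image_eqI[of _ _ e]) auto
  qed
  ultimately show ?thesis
    unfolding degree_def by (metis card_image)
qed

text \<open>Besides \<open>v\<close> itself and \<open>x\<close> there are exactly \<open>card (verts G) - 2\<close> vertices, so all of them must be
  neighbours of \<open>v\<close>.\<close>

lemma (in oriented_graph) adjacent_if_large_degree:
  assumes "card (verts G) \<le> degree G v + 2" 
    and "x \<in> verts G" "v \<in> verts G" "x \<noteq> v" "\<not> adjacent G v x"
    and "u \<in> verts G" "u \<noteq> v" "u \<noteq> x"
  shows "adjacent G v u"
proof -
  have "{u. adjacent G v u} = verts G - {v, x}"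
  proof (rule card_subset_eq)
    show le: "{u. adjacent G v u} \<subseteq> verts G - {v, x}"
      using adjacentD assms by blast
    show "card {u. adjacent G v u} = card (verts G - {v, x})"
      using assms card_mono[OF _ le]
      by (simp add: card_Diff_subset degree_eq_card_neighbours)
  qed simp
  then show ?thesis using assms by auto
qed

text \<open>The condition \<open>3 \<le> length xs\<close> is needed for the closed list to be a cycle. As every step of the list is
  either forward or backward, a bound on the backward steps bounds \<open>sigma_plus\<close> from below.\<close>

lemma (in oriented_graph) hamilton_cycle_of_list:
  assumes set: "set xs = verts G" and dist: "distinct xs" and len: "3 \<le> length xs"
    and adj: "successively (adjacent G) (xs @ [hd xs])"
  shows "\<exists>C. hamilton_oriented_cycle G C \<and> cycle_traversal C xs \<and>
    length xs \<le> sigma_plus C xs + backward (dominates G) (xs @ [hd xs])"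
proof -
  define n where "n = length xs"
  define A where "A = {e \<in> arcs G. \<exists>i<n. {tail G e, head G e} = {xs ! i, cyc_next xs i}}"
  define C where "C = \<lparr>verts = verts G, arcs = A, tail = tail G, head = head G\<rparr>"
  have next_i: "cyc_next xs i = (xs @ [hd xs]) ! Suc i" "xs ! i = (xs @ [hd xs]) ! i" 
    if "i < n" for i
    using that len hd_conv_nth[of xs] by (fastforce simp: cyc_next_def n_def nth_append mod_Suc)+
  have adj_i: "adjacent G (xs ! i) (cyc_next xs i)" if "i < n" for i
    using successively_nth[OF adj, of i] next_i[OF that] that by (simp add: n_def)
  have dom: "u \<rightarrow>\<^bsub>C\<^esub> v \<longleftrightarrow> u \<rightarrow>\<^bsub>G\<^esub> v \<and> (\<exists>i<n. {u, v} = {xs ! i, cyc_next xs i})" for u v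
    by (auto simp: C_def A_def arcs_ends_conv image_iff)
  have sub: "subgraph C G"
    by (rule subgraphI) (auto simp: C_def A_def compatible_def wf_digraph_def)
  have "parcs (mk_symmetric C) = {(u, v). u \<rightarrow>\<^bsub>C\<^esub> v \<or> v \<rightarrow>\<^bsub>C\<^esub> u}"
    by (auto simp: parcs_mk_symmetric arcs_ends_conv)
  also have "\<dots> = {(u, v). adjacent G u v \<and> (\<exists>i<n. {u, v} = {xs ! i, cyc_next xs i})}"
    by (auto simp: dom adjacent_def insert_commute)
  also have "\<dots> = (\<Union>i\<in>{..<length xs}. {(xs ! i, cyc_next xs i), (cyc_next xs i, xs ! i)})"
    using adj_i adjacent_sym by (fastforce simp: doubleton_eq_iff n_def)
  finally have trav: "cycle_traversal C xs"
    using len dist set by (simp add: cycle_traversal_def C_def)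
  have "backward (dominates G) (xs @ [hd xs]) = (\<Sum>i<n. of_bool (\<not> xs ! i \<rightarrow>\<^bsub>G\<^esub> cyc_next xs i))"
    unfolding backward_conv_sum by (rule sum.cong) (auto simp: next_i n_def)
  also have "\<dots> = card {i. i < n \<and> \<not> xs ! i \<rightarrow>\<^bsub>G\<^esub> cyc_next xs i}"
    by (simp add: of_bool_def sum.If_cases Int_def)
  finally have bw: "backward (dominates G) (xs @ [hd xs]) = card {i. i < n \<and> \<not> xs ! i \<rightarrow>\<^bsub>G\<^esub> cyc_next xs i}" .
  have "sigma_plus C xs = card {i. i < n \<and> xs ! i \<rightarrow>\<^bsub>G\<^esub> cyc_next xs i}"
    unfolding sigma_plus_def by (rule arg_cong[of _ _ card]) (auto simp: dom n_def)
  then have "sigma_plus C xs + backward (dominates G) (xs @ [hd xs]) = 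
      card ({i. i < n \<and> xs ! i \<rightarrow>\<^bsub>G\<^esub> cyc_next xs i} \<union> {i. i < n \<and> \<not> xs ! i \<rightarrow>\<^bsub>G\<^esub> cyc_next xs i})"
    unfolding bw by (subst card_Un_disjoint) auto
  also have "\<dots> = card {..<n}" by (rule arg_cong[of _ _ card]) auto
  finally show ?thesis
    using sub trav by (intro exI[of _ C])
      (auto simp: hamilton_oriented_cycle_def oriented_cycle_def spanning_def C_def n_def)
qed

section \<open>The Hamilton oriented cycle\<close>

theorem theorem1p4:
  fixes D :: "('a, 'b) pre_digraph" and n \<delta> :: nat
  assumes "oriented_graph D"
    and "n = card (verts D)"
    and "\<delta> = min_degree D"
    and "1 < \<delta>" and "real \<delta> < real n / 2"
    and "\<And>u v. \<lbrakk>u \<in> verts D; v \<in> verts D; u \<noteq> v; \<not> adjacent D u v\<rbrakk>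
           \<Longrightarrow> real (degree D u) + real (degree D v) \<ge> real n + real \<delta> - 2"
  shows "\<exists>C xs. hamilton_oriented_cycle D C \<and> cycle_traversal C xs \<and>
           real (sigma_max C xs) \<ge> real n - real \<delta>"
proof -
  interpret oriented_graph D by fact
  have "verts D \<noteq> {}" using assms(2,4,5) by auto
  then have "\<delta> \<in> degree D ` verts D" 
    unfolding assms(3) min_degree_def by (intro Min_in) auto
  then obtain x where x: "x \<in> verts D" "degree D x = \<delta>" by auto
  define T where "T = {t. adjacent D x t}"
  define S where "S = verts D - insert x T"
  have T: "T \<subseteq> verts D" "x \<notin> T" "card T = \<delta>" "finite T"
    using adjacentD[of x] x finite_subset[OF _ finite_verts, of T] 
    by (auto simp: T_def degree_eq_card_neighbours)
  have S: "card S + \<delta> + 1 = n" "finite S"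
    using T x card_mono[of "verts D" "insert x T"] unfolding S_def assms(2)
    by (auto simp: card_Diff_subset)
  have adj_S: "adjacent D v u" if "v \<in> S" "u \<in> verts D" "u \<noteq> v" "u \<noteq> x" for u v
  proof (rule adjacent_if_large_degree)
    have "\<not> adjacent D x v" "v \<in> verts D" "x \<noteq> v" using that by (auto simp: S_def T_def)
    then show "\<not> adjacent D v x" "v \<in> verts D" "x \<noteq> v" 
      using adjacent_sym by auto
    \<comment> \<open>The degree condition for \<open>x\<close> and \<open>v\<close>, from which \<open>degree D x = \<delta>\<close> cancels.\<close>
    then show "card (verts D) \<le> degree D v + 2"
      using assms(6)[of x v] x \<open>\<not> adjacent D x v\<close> assms(2) by simp
  qed (use that x in auto)
  obtain vs where vs: "distinct vs" "set vs = S" "successively (dominates D) vs"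
    using tournament_hamilton_path[OF S(2), of "dominates D"] adj_S
    by (auto simp: adjacent_def S_def)
  obtain ts where ts: "distinct ts" "set ts = T" using finite_distinct_list[OF T(4)] by auto
  have len: "length vs = card S" "length ts = \<delta>" 
    using vs ts T(3) distinct_card by metis+
  obtain t0 t1 ms where ms: "ts = t0 # t1 # ms"
    using len(2) assms(4) by (cases ts; cases "tl ts") auto
  have len_ms: "length ms + 2 = \<delta>" "length ms + 2 \<le> length vs"
    using len ms S(1) assms(5) by auto
  have adj_T: "adjacent D v t" if "v \<in> S" "t \<in> T" for v t
    using that T by (intro adj_S) (auto simp: S_def)
  obtain r t t' where tt: "{t, t'} = {t0, t1}"
    and few: "backward (dominates D) (x # t # splice (rotate r vs) ms @ [t', x]) \<le> length ms + 2"
  proof -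
    have "\<exists>r t t'. {t, t'} = {t0, t1} \<and>
      backward (dominates D) (x # t # splice (rotate r vs) ms @ [t', x]) \<le> length ms + 2"
    proof (rule exists_few_backward[OF vs(3) len_ms(2)])
      fix v t assume "v \<in> set vs" "t \<in> {t0, t1} \<union> set ms"
      then show "t \<rightarrow>\<^bsub>D\<^esub> v \<longleftrightarrow> \<not> v \<rightarrow>\<^bsub>D\<^esub> t"
        using adj_T vs ts ms adjacent_iff_one_way[of v t] by auto
    next
      fix t assume "t \<in> {t0, t1}"
      then show "t \<rightarrow>\<^bsub>D\<^esub> x \<longleftrightarrow> \<not> x \<rightarrow>\<^bsub>D\<^esub> t"
        using ts ms adjacent_iff_one_way[of x t] by (auto simp: T_def)
    qed
    then show ?thesis using that by blast
  qed
  define ws where "ws = rotate r vs"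
  have ws: "distinct ws" "set ws = S" "length ws = card S" "ws \<noteq> []" "length ms < length ws"
    using vs len len_ms by (auto simp: ws_def)
  define xs where "xs = x # t # splice ws ms @ [t']"
  have sp: "set (splice ws ms) = S \<union> set ms"
    using set_shuffles[OF splice_in_shuffles] ws(2) by metis
  have ttT: "t \<noteq> t'" "t \<in> T" "t' \<in> T" "t \<notin> set ms" "t' \<notin> set ms" "T = {t, t'} \<union> set ms"
    using tt ts ms by (auto simp: doubleton_eq_iff)
  have "distinct (splice ws ms)"
    using ws ts ms sp distinct_disjoint_shuffles[of ws ms] by (auto simp: S_def)
  then have dist: "distinct xs"
    using ttT T(2) sp by (auto simp: xs_def S_def)
  have set: "set xs = verts D"
    using ttT(6) sp T(1) x(1) by (auto simp: xs_def S_def)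
  have adj_sp: "successively (adjacent D) (splice ws ms)"
    using ws adj_S adj_T adjacent_sym ttT(6) by (intro successively_splice) (auto simp: S_def)
  have "adjacent D x t" "adjacent D t' x" using ttT adjacent_sym by (auto simp: T_def)
  moreover have "hd ws \<in> S" "last ws \<in> S" using ws by auto
  then have "adjacent D t (hd ws)" "adjacent D (last ws) t'" 
    using adj_T ttT adjacent_sym by auto
  ultimately have adj: "successively (adjacent D) (xs @ [hd xs])"
    using adj_sp ws by (auto simp: xs_def successively_append_iff successively_Cons hd_splice last_splice)
  obtain C where C: "hamilton_oriented_cycle D C" "cycle_traversal C xs"
    "length xs \<le> sigma_plus C xs + backward (dominates D) (xs @ [hd xs])"
    using hamilton_cycle_of_list[OF set dist _ adj] ws by (auto simp: xs_def)
  moreover have "length xs = n" using distinct_card[OF dist] set assms(2) by simp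
  moreover have "backward (dominates D) (xs @ [hd xs]) \<le> \<delta>"
    using few len_ms by (simp add: xs_def ws_def)
  ultimately show ?thesis by (intro exI[of _ C] exI[of _ xs]) (auto simp: sigma_max_def)
qed

end
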